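(* Let $\mathbf{g}_1, \mathbf{g}_2\in\mathbb{N}_0^d$ with $\mathbf{g}_1\le\mathbf{g}_2$ be such that $\mathbf{g}_2$ is a multiple of $\mathbf{g}_2-\mathbf{g}_1$ and $2\mathbf{g}_1\neq \mathbf{g}_2$. Then every Frobenius GNS in $\mathcal{F}(\mathbf{g}_2 + \mathbf{1};\mathbf{g}_1)$ is non-irreducible. In particular, every Frobenius GNS in $\mathcal{M}\mathcal{F}(\mathbf{g}_2 + \mathbf{1};\mathbf{g}_1)$ is an ANI, i.e. it is an atom (of $\mathcal{F}(\mathbf{g}_2+\mathbf{1})$) and non-irreducible.
   Context: $\mathbb{N}_0$ is the set of non-negative integers and $d\ge 1$ is an integer. A generalized numerical semigroup (GNS) in $\mathbb{N}_0^d$ is a subset $S\subseteq\mathbb{N}_0^d$ closed under addition, containing $\mathbf{0}$, with finite complement $\operatorname{H}(S)=\mathbb{N}_0^d\setminus S$ (the gaps of $S$). On $\mathbb{N}_0^d$, $\leq$ is the componentwise partial order; $\mathbf{1}=(1,\dots,1)$. A multiple of $\mathbf{x}$ is an element $k\mathbf{x}$ with $k$ a positive integer. Corner element: the corner element of a GNS $S$ is the unique $\mathbf{c}=(c_1,\dots,c_d)\in S$ such that (1) for all $i$ and all $x\in\mathbb{N}_0$ with $x\ge c_i$, every vector of $\mathbb{N}_0^d$ with $i$-th coordinate $x$ lies in $S$; (2) for all $i$, there are $z_j\in\mathbb{N}_0$ ($j\neq i$) such that $(z_1,\dots,z_{i-1},c_i-1,z_{i+1},\dots,z_d)\notin S$.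 (If $\operatorname{H}(S)\ne\emptyset$, then $c_i=1+\max\{h_i:\mathbf{h}\in \operatorname{H}(S)\}$ for each $i$.) $\mathcal{F}(\mathbf{c})$ is the set of all GNSs in $\mathbb{N}_0^d$ with corner element $\mathbf{c}$. An element $S\in\mathcal{F}(\mathbf{c})$ is an atom if it cannot be written as an intersection of two GNSs in $\mathcal{F}(\mathbf{c})$ both properly containing $S$. For $\mathbf{h}\le\mathbf{c}-\mathbf{1}$, $\mathcal{F}(\mathbf{c};\mathbf{h})=\{S\in\mathcal{F}(\mathbf{c}) : \mathbf{h}\in\operatorname{H}(S)\}$, and $\mathcal{M}\mathcal{F}(\mathbf{c};\mathbf{h})$ is the set of its elements maximal with respect to inclusion. A GNS $S$ is Frobenius if $\operatorname{H}(S)$ has a unique maximal element with respect to $\le$ (its Frobenius element $\operatorname{F}(S)$; then $\operatorname{F}(S)=\mathbf{c}-\mathbf{1}$ where $\mathbf{c}$ is the corner element). A GNS $S$ is irreducible if it cannot be expressed as an intersection of two GNSs properly containing $S$, and non-irreducible otherwise. *)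

theory Defs
  imports "HOL-Analysis.Analysis"
begin

text \<open>
  The monoid \<open>\<nat>\<^sub>0\<^sup>d\<close> is the type \<^typ>\<open>nat ^ 'n\<close> with \<open>d = CARD('n)\<close>; since types are
  nonempty, \<open>d \<ge> 1\<close>. The library's order on this type is the componentwise one, \<open>1\<close> is the
  all-ones vector, and complements of sets are taken in \<open>\<nat>\<^sub>0\<^sup>d\<close>.
\<close>

definition gaps :: "(nat ^ 'n) set \<Rightarrow> (nat ^ 'n) set" where
  "gaps S = - S"

definition gns :: "(nat ^ 'n) set \<Rightarrow> bool" where
  "gns S \<longleftrightarrow> (\<forall>x\<in>S. \<forall>y\<in>S. x + y \<in> S) \<and> 0 \<in> S \<and> finite (gaps S)"

definition is_multiple_of :: "nat ^ 'n \<Rightarrow> nat ^ 'n \<Rightarrow> bool" where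
  "is_multiple_of y x \<longleftrightarrow> (\<exists>k>0. y = k *s x)"

text \<open>
  In the last clause, a vector with \<open>i\<close>-th coordinate \<open>c\<^sub>i - 1\<close> lies outside \<open>\<nat>\<^sub>0\<^sup>d\<close>, and hence
  outside \<open>S\<close>, when \<open>c\<^sub>i = 0\<close>; the explicit disjunct replaces the truncated subtraction.
  It matters only for \<open>S = \<nat>\<^sub>0\<^sup>d\<close>, whose corner element is \<open>0\<close>.
\<close>

definition is_corner_element :: "(nat ^ 'n) set \<Rightarrow> nat ^ 'n \<Rightarrow> bool" where
  "is_corner_element S c \<longleftrightarrow>
     c \<in> S \<and>
     (\<forall>i. \<forall>x \<ge> c $ i. \<forall>v. v $ i = x \<longrightarrow> v \<in> S) \<and>
     (\<forall>i. c $ i = 0 \<or> (\<exists>z. z $ i = c $ i - 1 \<and> z \<notin> S))"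

lemma ex1_corner_element:
  fixes S :: "(nat ^ 'n) set"
  assumes "gns S"
  shows "\<exists>!c. is_corner_element S c"
proof (rule ex_ex1I)
  have fin: "finite (gaps S)"
    using assms by (simp add: gns_def)
  define c :: "nat ^ 'n" where
    "c = (\<chi> i. if gaps S = {} then 0 else Suc (Max ((\<lambda>h. h $ i) ` gaps S)))"
  have above: "v \<in> S" if "c $ i \<le> v $ i" for v i
  proof (rule ccontr)
    assume "v \<notin> S"
    then have v: "v \<in> gaps S"
      by (simp add: gaps_def)
    then have "v $ i \<le> Max ((\<lambda>h. h $ i) ` gaps S)"
      using fin by (intro Max_ge) auto
    with v that show False
      by (auto simp: c_def split: if_splits)
  qed
  have below: "c $ i = 0 \<or> (\<exists>z. z $ i = c $ i - 1 \<and> z \<notin> S)" for i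
  proof (cases "gaps S = {}")
    case False
    then have "Max ((\<lambda>h. h $ i) ` gaps S) \<in> (\<lambda>h. h $ i) ` gaps S"
      using fin by (intro Max_in) auto
    with False show ?thesis
      by (auto simp: c_def gaps_def)
  qed (simp add: c_def)
  show "\<exists>c. is_corner_element S c"
    unfolding is_corner_element_def using above below by blast
next
  have le: "c $ i \<le> c' $ i" if cc: "is_corner_element S c" "is_corner_element S c'" for c c' i
  proof (rule ccontr)
    assume less: "\<not> c $ i \<le> c' $ i"
    then obtain z where "z $ i = c $ i - 1" "z \<notin> S"
      using cc(1) unfolding is_corner_element_def by force
    moreover from this(1) less have "c' $ i \<le> z $ i"
      by linarith
    ultimately show False
      using cc(2) unfolding is_corner_element_def by blast
  qed
  show "c = c'" if "is_corner_element S c" "is_corner_element S c'" for c c'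
    using le[OF that] le[OF that(2,1)] by (simp add: vec_eq_iff order_antisym)
qed

definition gns_with_corner :: "nat ^ 'n \<Rightarrow> (nat ^ 'n) set set" where
  "gns_with_corner c = {S. gns S \<and> is_corner_element S c}"

definition gns_with_corner_gap :: "nat ^ 'n \<Rightarrow> nat ^ 'n \<Rightarrow> (nat ^ 'n) set set" where
  "gns_with_corner_gap c h = {S \<in> gns_with_corner c. h \<in> gaps S}"

definition max_gns_with_corner_gap :: "nat ^ 'n \<Rightarrow> nat ^ 'n \<Rightarrow> (nat ^ 'n) set set" where
  "max_gns_with_corner_gap c h =
     {S \<in> gns_with_corner_gap c h. \<not> (\<exists>T \<in> gns_with_corner_gap c h. S \<subset> T)}"

definition atom :: "nat ^ 'n \<Rightarrow> (nat ^ 'n) set \<Rightarrow> bool" where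
  "atom c S \<longleftrightarrow> S \<in> gns_with_corner c \<and>
     \<not> (\<exists>S1 \<in> gns_with_corner c. \<exists>S2 \<in> gns_with_corner c.
           S \<subset> S1 \<and> S \<subset> S2 \<and> S = S1 \<inter> S2)"

definition frobenius_gns :: "(nat ^ 'n) set \<Rightarrow> bool" where
  "frobenius_gns S \<longleftrightarrow> gns S \<and>
     (\<exists>!f. f \<in> gaps S \<and> \<not> (\<exists>h \<in> gaps S. f \<le> h \<and> f \<noteq> h))"

definition irreducible_gns :: "(nat ^ 'n) set \<Rightarrow> bool" where
  "irreducible_gns S \<longleftrightarrow> gns S \<and>
     \<not> (\<exists>S1 S2. gns S1 \<and> gns S2 \<and> S \<subset> S1 \<and> S \<subset> S2 \<and> S = S1 \<inter> S2)"

definition non_irreducible_gns :: "(nat ^ 'n) set \<Rightarrow> bool" where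
  "non_irreducible_gns S \<longleftrightarrow> gns S \<and> \<not> irreducible_gns S"

definition ani :: "nat ^ 'n \<Rightarrow> (nat ^ 'n) set \<Rightarrow> bool" where
  "ani c S \<longleftrightarrow> atom c S \<and> non_irreducible_gns S"

end

theory Submission
  imports Defs
begin

text \<open>
  Let \<open>S\<close> be a Frobenius GNS with corner element \<open>g\<^sub>2 + 1\<close>, so that \<open>g\<^sub>2\<close> is its greatest gap,
  and suppose \<open>g\<^sub>1 \<notin> S\<close>. As \<open>g\<^sub>2\<close> is a multiple of \<open>g\<^sub>2 - g\<^sub>1\<close>, the latter is a gap too, so \<open>g\<^sub>2\<close>
  is a sum of two distinct gaps. If \<open>h\<close> is maximal among the summands of such decompositions of
  \<open>g\<^sub>2\<close>, then \<open>S \<union> {h}\<close> is again a GNS, and \<open>S = (S \<union> {h}) \<inter> (S \<union> {g\<^sub>2})\<close> is reducible. Moreover,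
  if a maximal element of \<open>\<F>(c; h)\<close> is an intersection of two members of \<open>\<F>(c)\<close>, then one of
  them has the gap \<open>h\<close>, so it cannot be strictly larger.
\<close>

lemma less_eq_vec_iff_add:
  fixes x y :: "nat ^ 'n"
  shows "x \<le> y \<longleftrightarrow> (\<exists>z. y = x + z)"
proof
  assume "x \<le> y"
  then have "y = x + (y - x)"
    by (simp add: vec_eq_iff less_eq_vec_def)
  then show "\<exists>z. y = x + z" ..
qed (auto simp: less_eq_vec_def)

lemma vec_add_eq_self_iff:
  fixes x y :: "nat ^ 'n"
  shows "x + y = x \<longleftrightarrow> y = 0"
  by (simp add: vec_eq_iff)

lemma gns_add: "gns S \<Longrightarrow> x \<in> S \<Longrightarrow> y \<in> S \<Longrightarrow> x + y \<in> S"
  by (simp add: gns_def)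

lemma gns_zero: "gns S \<Longrightarrow> 0 \<in> S"
  by (simp add: gns_def)

lemma gns_scale: "gns S \<Longrightarrow> x \<in> S \<Longrightarrow> k *s x \<in> S"
proof (induction k)
  case 0
  have "0 *s x = 0"
    by (simp add: vec_eq_iff)
  with 0 show ?case
    by (simp add: gns_zero)
next
  case (Suc k)
  have "Suc k *s x = x + k *s x"
    by (simp add: vec_eq_iff)
  with Suc show ?case
    by (simp add: gns_add)
qed

text \<open>The only new sums are \<open>h + h\<close> and \<open>h + s\<close>; for
  \<open>s = 0\<close> the sum is \<open>h\<close> itself, which is inserted rather than required to
  lie in \<open>S\<close>.\<close>

lemma gns_insert:
  assumes "gns S" and "h + h \<in> S" and "\<And>s. s \<in> S \<Longrightarrow> s \<noteq> 0 \<Longrightarrow> h + s \<in> S"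
  shows "gns (insert h S)"
  unfolding gns_def
proof (intro conjI ballI)
  have translate: "h + s \<in> insert h S" if "s \<in> S" for s
    using that assms(3) by (cases "s = 0") auto
  fix x y
  assume "x \<in> insert h S" "y \<in> insert h S"
  then show "x + y \<in> insert h S"
    using assms(2) translate translate[unfolded add.commute[of h]] gns_add[OF assms(1)] by blast
next
  show "0 \<in> insert h S"
    using assms(1) by (simp add: gns_zero)
  show "finite (gaps (insert h S))"
    using assms(1) by (auto simp: gns_def gaps_def intro: finite_subset[rotated])
qed

lemma gns_insert_greatest_gap:
  assumes "gns S" and "f \<notin> S" and greatest: "\<And>g. g \<notin> S \<Longrightarrow> g \<le> f"
  shows "gns (insert f S)"
proof -
  have "f + s \<in> S" if "s \<noteq> 0" for s
  proof (rule ccontr)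
    assume "f + s \<notin> S"
    then have "f + s \<le> f"
      by (rule greatest)
    moreover have "f \<le> f + s"
      by (auto simp: less_eq_vec_iff_add)
    ultimately have "f + s = f"
      by (rule antisym)
    with that show False
      by (simp add: vec_add_eq_self_iff)
  qed
  \<comment> \<open>This makes \<open>f + f\<close> one of the nonzero translates just
    treated.\<close>
  moreover have "f \<noteq> 0"
    using assms(1,2) gns_zero by blast
  ultimately show ?thesis
    using assms(1) by (intro gns_insert) auto
qed

text \<open>The case \<open>a = b\<close> has to stay: in a pseudo-symmetric GNS, which is
  irreducible, \<open>f/2\<close> is a gap.\<close>

lemma irreducible_gns_gap_decomposition:
  fixes S :: "(nat ^ 'n) set"
  assumes irr: "irreducible_gns S"
    and f: "f \<notin> S" and greatest: "\<And>g. g \<notin> S \<Longrightarrow> g \<le> f"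
    and "a \<notin> S" "b \<notin> S" "a + b = f"
  shows "a = b"
proof (rule ccontr)
  assume "a \<noteq> b"
  have S: "gns S"
    using irr by (simp add: irreducible_gns_def)
  define A where "A = {h. h \<notin> S \<and> (\<exists>h'. h' \<notin> S \<and> h + h' = f \<and> h \<noteq> h')}"
  have "finite A"
    by (rule finite_subset[of _ "gaps S"]) (use S in \<open>auto simp: A_def gns_def gaps_def\<close>)
  moreover have "a \<in> A"
    using assms \<open>a \<noteq> b\<close> by (auto simp: A_def)
  ultimately obtain h where "h \<in> A" and max: "\<And>x. x \<in> A \<Longrightarrow> h \<le> x \<Longrightarrow> h = x"
    using finite_has_maximal[of A] by blast
  then obtain h' where h: "h \<notin> S" and h': "h' \<notin> S" and sum: "h + h' = f" and ne: "h \<noteq> h'"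
    by (auto simp: A_def)
  \<comment> \<open>Both claims below refute a gap by producing an element of \<open>A\<close>
    strictly above \<open>h\<close>; \<open>h'\<close> may serve as this element since
    \<open>A\<close> is closed under swapping summands.\<close>
  have maximal: "x = 0" if "h + x \<in> A" for x
    using max[OF that] by (metis less_eq_vec_iff_add vec_add_eq_self_iff)
  have "h' \<in> A"
    using h h' sum ne by (auto simp: A_def add.commute)
  have cancel: "h' = x + t" if "f = h + x + t" for x t
    using that sum by (simp add: add.assoc)
  \<comment> \<open>Otherwise \<open>f = (h + s) + t\<close> with \<open>t\<close> a gap, because
    \<open>h' = s + t\<close> is one. If the summands differ, \<open>h + s\<close> is in
    \<open>A\<close>; if they agree, \<open>h' = h + (s + s)\<close> is too large.\<close>
  have translate: "h + s \<in> S" if s: "s \<in> S" "s \<noteq> 0" for s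
  proof (rule ccontr)
    assume gap: "h + s \<notin> S"
    then obtain t where t: "f = h + s + t"
      using greatest less_eq_vec_iff_add by metis
    then have h'_eq: "h' = s + t"
      by (rule cancel)
    with h' s S have "t \<notin> S"
      by (auto simp: gns_add)
    show False
    proof (cases "h + s = t")
      case True
      with h'_eq \<open>h' \<in> A\<close> have "h + (s + s) \<in> A"
        by (metis add.commute add.left_commute)
      then have "s + s = 0"
        by (rule maximal)
      with s show False
        by (simp add: vec_eq_iff)
    next
      case False
      with gap \<open>t \<notin> S\<close> t have "h + s \<in> A"
        by (auto simp: A_def)
      with maximal s show False
        by blast
    qed
  qed
  have "h \<noteq> 0"
    using h S gns_zero by blast
  \<comment> \<open>The same argument with \<open>h\<close> for \<open>s\<close>. Now
    \<open>t\<close> is a gap by \<open>translate\<close>, where \<open>t \<noteq> 0\<close> comes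
    from \<open>h \<noteq> h'\<close>.\<close>
  have "h + h \<in> S"
  proof (rule ccontr)
    assume gap: "h + h \<notin> S"
    then obtain t where t: "f = h + h + t"
      using greatest less_eq_vec_iff_add by metis
    then have h'_eq: "h' = h + t"
      by (rule cancel)
    with ne have "t \<noteq> 0"
      by auto
    with translate h' h'_eq have "t \<notin> S"
      by auto
    show False
    proof (cases "h + h = t")
      case True
      with h'_eq \<open>h' \<in> A\<close> \<open>t \<noteq> 0\<close> maximal show False
        by blast
    next
      case False
      with gap \<open>t \<notin> S\<close> t have "h + h \<in> A"
        by (auto simp: A_def)
      with maximal \<open>h \<noteq> 0\<close> show False
        by blast
    qed
  qed
  then have "gns (insert h S)"
    using S translate by (intro gns_insert)
  moreover have "gns (insert f S)"
    using S f greatest by (rule gns_insert_greatest_gap)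
  \<comment> \<open>Equality would force \<open>h' = 0\<close>, which is in
    \<open>S\<close>.\<close>
  moreover have "h \<noteq> f"
    using sum h' S gns_zero vec_add_eq_self_iff by metis
  then have "S = insert h S \<inter> insert f S"
    using h f by auto
  ultimately show False
    using irr h f unfolding irreducible_gns_def by blast
qed

text \<open>By finiteness every gap lies below a maximal one, so a unique maximal gap is the
  greatest; its coordinates are then the coordinatewise maxima, which the corner element exceeds by
  one.\<close>

lemma frobenius_gns_greatest_gap:
  fixes S :: "(nat ^ 'n) set"
  assumes frob: "frobenius_gns S" and corner: "is_corner_element S (f + 1)"
  shows "f \<notin> S" and "g \<notin> S \<Longrightarrow> g \<le> f"
proof -
  obtain m where m: "m \<notin> S"
    and uniq: "\<And>x. x \<notin> S \<Longrightarrow> \<not> (\<exists>h\<in>gaps S. x \<le> h \<and> x \<noteq> h) \<Longrightarrow> x = m"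
    using frob unfolding frobenius_gns_def gaps_def by auto
  have fin: "finite (gaps S)"
    using frob by (simp add: frobenius_gns_def gns_def)
  have greatest: "g \<le> m" if g: "g \<notin> S" for g
  proof -
    obtain x where "x \<in> gaps S" "g \<le> x" "\<And>y. y \<in> gaps S \<Longrightarrow> x \<le> y \<Longrightarrow> x = y"
      using finite_has_maximal2[OF fin, of g] g unfolding gaps_def by blast
    with uniq show ?thesis
      by (metis ComplD gaps_def)
  qed
  have "m $ i = f $ i" for i
  proof (rule antisym)
    show "m $ i \<le> f $ i"
      using corner m unfolding is_corner_element_def by (metis Suc_eq_plus1 not_less_eq_eq one_index vector_add_component)
    \<comment> \<open>All coordinates of \<open>f + 1\<close> are positive, so the zero disjunct of
      the corner condition cannot occur.\<close>
    obtain z where "z $ i = f $ i" "z \<notin> S"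
      using corner unfolding is_corner_element_def by force
    then show "f $ i \<le> m $ i"
      using greatest by (metis less_eq_vec_def)
  qed
  then have "m = f"
    by (simp add: vec_eq_iff)
  with m greatest show "f \<notin> S" and "g \<notin> S \<Longrightarrow> g \<le> f"
    by auto
qed

lemma max_gns_with_corner_gap_atom:
  assumes "S \<in> max_gns_with_corner_gap c h"
  shows "atom c S"
  using assms
  unfolding atom_def max_gns_with_corner_gap_def gns_with_corner_gap_def gaps_def by blast

theorem proposition5p2:
  fixes g1 g2 :: "nat ^ 'n"
  assumes "g1 \<le> g2"
    and "is_multiple_of g2 (g2 - g1)"
    and "2 *s g1 \<noteq> g2"
  shows "(\<forall>S \<in> gns_with_corner_gap (g2 + 1) g1.
            frobenius_gns S \<longrightarrow> non_irreducible_gns S) \<and>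
         (\<forall>S \<in> max_gns_with_corner_gap (g2 + 1) g1.
            frobenius_gns S \<longrightarrow> ani (g2 + 1) S)"
proof -
  have non_irr: "non_irreducible_gns S"
    if mem: "S \<in> gns_with_corner_gap (g2 + 1) g1" and frob: "frobenius_gns S" for S
  proof -
    have S: "gns S" and corner: "is_corner_element S (g2 + 1)" and g1: "g1 \<notin> S"
      using mem by (auto simp: gns_with_corner_gap_def gns_with_corner_def gaps_def)
    note g2 = frobenius_gns_greatest_gap[OF frob corner]
    have sum: "g1 + (g2 - g1) = g2"
      using assms(1) by (simp add: vec_eq_iff less_eq_vec_def)
    have "g2 - g1 \<notin> S"
      using assms(2) g2(1) gns_scale[OF S] unfolding is_multiple_of_def by metis
    \<comment> \<open>Here \<open>2 *s g1 \<noteq> g2\<close> excludes equal summands.\<close>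
    moreover have "2 *s g1 = g1 + g1"
      by (simp add: vec_eq_iff)
    with sum assms(3) have "g1 \<noteq> g2 - g1"
      by metis
    ultimately have "\<not> irreducible_gns S"
      using irreducible_gns_gap_decomposition[OF _ g2 g1 _ sum] by blast
    with S show ?thesis
      by (simp add: non_irreducible_gns_def)
  qed
  moreover have "ani (g2 + 1) S"
    if "S \<in> max_gns_with_corner_gap (g2 + 1) g1" and "frobenius_gns S" for S
    using that non_irr max_gns_with_corner_gap_atom
    by (auto simp: ani_def max_gns_with_corner_gap_def)
  ultimately show ?thesis
    by blast
qed

end
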